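(* Let $f:\mathbb{Z}_+\to\mathbb{C}$ and $F(x)=1+\sum_{\ell=1}^\infty f(\ell)x^\ell$. Then for every $k\in\mathbb{Z}_+$ and $n\in\mathbb{Z}_{\geq0}$, \[c_n:=\sum_{C\in\mathcal{C}_n^{(k)}}\prod_{i=1}^{|\mathbf{u}(C)|}f(\mathbf{u}(C)_i)=\frac{1}{kn+1}[x^n]F(x)^{kn+1},\] and the generating function $C(x)=\sum_{n\geq0}c_nx^n$ satisfies $C(x)=F(xC(x)^k)$.
   Context: For $k\in\mathbb{Z}_+$, $\mathcal{C}_n^{(k)}$ (the $k$-Catalan paths of size $n$) is the set of lattice paths from $(0,0)$ to $((k+1)n,0)$ with step set $\{(1,k),(1,-1)\}$ that never go below the $x$-axis. For $C\in\mathcal{C}_n^{(k)}$, $\mathbf{u}(C)$ is the vector recording, in order, the lengths of the maximal blocks of consecutive $(1,k)$ steps in $C$. Empty products equal $1$; $[x^n]$ denotes coefficient extraction. *)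

theory Defs
  imports
    Complex_Main
    "HOL-Library.Product_Plus"
    "HOL-Computational_Algebra.Formal_Power_Series"
begin

(* A lattice path starting at the origin is represented by its list of step vectors,
   so that the vertex reached after i steps is the sum of the first i entries. *)
definition catalan_paths :: "nat \<Rightarrow> nat \<Rightarrow> (int \<times> int) list set" where
  "catalan_paths k n =
     {C. set C \<subseteq> {(1, int k), (1, - 1)}
       \<and> sum_list C = (int ((k + 1) * n), 0)
       \<and> (\<forall>i \<le> length C. 0 \<le> snd (sum_list (take i C)))}"

function block_lengths :: "'a \<Rightarrow> 'a list \<Rightarrow> nat list" where
  "block_lengths s [] = []"
| "block_lengths s (x # xs) =
     (if x = s then Suc (length (takeWhile (\<lambda>y. y = s) xs))
                      # block_lengths s (dropWhile (\<lambda>y. y = s) xs)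
      else block_lengths s xs)"
  by pat_completeness auto
termination
  by (relation "measure (\<lambda>(s, xs). length xs)") (auto simp: less_Suc_eq_le length_dropWhile_le)

definition up_blocks :: "nat \<Rightarrow> (int \<times> int) list \<Rightarrow> nat list" where
  "up_blocks k C = block_lengths (1, int k) C"

(* The value f 0 is never used here or in path_sum, where all block lengths are positive:
   f stands for a function on the positive integers. *)
definition unit_series :: "(nat \<Rightarrow> complex) \<Rightarrow> complex fps" where
  "unit_series f = Abs_fps (\<lambda>l. if l = 0 then 1 else f l)"

definition path_sum :: "(nat \<Rightarrow> complex) \<Rightarrow> nat \<Rightarrow> nat \<Rightarrow> complex" where
  "path_sum f k n =
     (\<Sum>C \<in> catalan_paths k n. \<Prod>i < length (up_blocks k C). f (up_blocks k C ! i))"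

end

theory Submission
  imports Defs
begin

text \<open>
  Append a final down step to every path. A path with a final down step splits uniquely into chunks
  consisting of \<open>l \<ge> 0\<close> up steps and one down step, and the weight of a chunk is the coefficient
  of \<open>x\<^sup>l\<close> in \<open>F\<close>. Let \<open>t j n\<close> be the total weight of the paths with \<open>n\<close> up steps that start
  at height \<open>j\<close> and stop when they reach height \<open>0\<close>. Splitting off the first chunk gives
  \<open>t (j + 1) n = (\<Sum>l\<le>n. F\<^sub>l * t (j + k * l) (n - l))\<close>. Both claims follow from
  this recursion by induction on the number \<open>j + k * n\<close> of chunks: first
  \<open>t j n = j / (j + k * n) * [x\<^sup>n] F\<^bsup>j + k * n\<^esup>\<close>, and second that the generating function of \<open>t j\<close>
  is the \<open>j\<close>-th power of that of \<open>t 1\<close>, whereupon the recursion for \<open>j = 0\<close> is the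
  functional equation.
\<close>

section \<open>Block lengths and path weights\<close>

lemma block_lengths_append_neq:
  assumes "d \<noteq> s"
  shows "block_lengths s (xs @ [d]) = block_lengths s xs"
  using assms
proof (induction s xs rule: block_lengths.induct)
  case (2 s x xs)
  show ?case
  proof (cases "x = s")
    case True
    have "takeWhile (\<lambda>y. y = s) (xs @ [d]) = takeWhile (\<lambda>y. y = s) xs"
      using 2(3) by (induction xs) auto
    moreover have "dropWhile (\<lambda>y. y = s) (xs @ [d]) = dropWhile (\<lambda>y. y = s) xs @ [d]"
      using 2(3) by (induction xs) auto
    ultimately show ?thesis
      using 2 True by simp
  qed (use 2 in simp)
qed auto

lemma block_lengths_replicate_append:
  assumes "d \<noteq> s"
  shows "block_lengths s (replicate l s @ d # xs) = (if l = 0 then [] else [l]) @ block_lengths s xs"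
proof (cases l)
  case (Suc m)
  have "takeWhile (\<lambda>y. y = s) (replicate m s @ d # xs) = replicate m s"
    using assms by (induction m) auto
  moreover have "dropWhile (\<lambda>y. y = s) (replicate m s @ d # xs) = d # xs"
    using assms by (induction m) auto
  ultimately show ?thesis
    using Suc assms by simp
qed (use assms in simp)

abbreviation up :: "nat \<Rightarrow> int \<times> int" where "up k \<equiv> (1, int k)"
abbreviation down :: "int \<times> int" where "down \<equiv> (1, - 1)"

definition weight :: "(nat \<Rightarrow> complex) \<Rightarrow> nat \<Rightarrow> (int \<times> int) list \<Rightarrow> complex" where
  "weight f k C = prod_list (map f (up_blocks k C))"

text \<open>For \<open>l = 0\<close> the chunk contributes no block, which matches the constant
  coefficient 1 of \<open>unit_series f\<close>.\<close>

lemma weight_chunk: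
  "weight f k (replicate l (up k) @ down # C) = fps_nth (unit_series f) l * weight f k C"
  by (simp add: weight_def up_blocks_def unit_series_def block_lengths_replicate_append
      del: block_lengths.simps)

lemma weight_append_down: "weight f k (C @ [down]) = weight f k C"
  by (simp add: weight_def up_blocks_def block_lengths_append_neq)

lemma path_sum_weight: "path_sum f k n = (\<Sum>C \<in> catalan_paths k n. weight f k C)"
  unfolding path_sum_def weight_def
  by (intro sum.cong refl) (simp add: prod.list_conv_set_nth lessThan_atLeast0)

section \<open>Paths stopped at height 0 and their splitting into chunks\<close>

text \<open>Only proper prefixes are tested, so that the last vertex may lie on the axis.\<close>

definition stays_pos :: "int \<Rightarrow> (int \<times> int) list \<Rightarrow> bool" where
  "stays_pos h C \<longleftrightarrow> (\<forall>i < length C. 0 < h + snd (sum_list (take i C)))"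

lemma stays_pos_Nil [simp]: "stays_pos h []"
  by (simp add: stays_pos_def)

lemma stays_pos_Cons [simp]: "stays_pos h (s # C) \<longleftrightarrow> 0 < h \<and> stays_pos (h + snd s) C"
  by (simp add: stays_pos_def All_less_Suc2 add.assoc)

text \<open>Up steps never lower the height, so positivity is at stake only after the down
  step.\<close>

lemma stays_pos_replicate_up:
  "0 < h \<Longrightarrow> stays_pos h (replicate l (up k) @ down # C) \<longleftrightarrow> stays_pos (h + int (k * l) - 1) C"
proof (induction l arbitrary: h)
  case (Suc l)
  show ?case
    using Suc.prems Suc.IH[of "h + int k"] by (simp add: algebra_simps)
qed simp

text \<open>The number of down steps makes the path end at height 0; it is also the number of
  chunks.\<close>

definition passage_paths :: "nat \<Rightarrow> nat \<Rightarrow> nat \<Rightarrow> (int \<times> int) list set" where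
  "passage_paths k j n =
     {C. set C \<subseteq> {up k, down} \<and> count_list C (up k) = n \<and> count_list C down = k * n + j
       \<and> stays_pos (int j) C}"

lemma length_steps:
  "set C \<subseteq> {up k, down} \<Longrightarrow> length C = count_list C (up k) + count_list C down"
  by (induction C) auto

lemma sum_list_steps:
  "set C \<subseteq> {up k, down} \<Longrightarrow> sum_list C =
     (int (count_list C (up k)) + int (count_list C down),
      int k * int (count_list C (up k)) - int (count_list C down))"
  by (induction C) (auto simp: algebra_simps zero_prod_def)

lemma finite_passage_paths: "finite (passage_paths k j n)"
proof (rule finite_subset)
  show "passage_paths k j n \<subseteq> {C. set C \<subseteq> {up k, down} \<and> length C = n + (k * n + j)}"
    using length_steps by (auto simp: passage_paths_def)
  show "finite {C. set C \<subseteq> {up k, down} \<and> length C = n + (k * n + j)}"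
    by (rule finite_lists_length_eq) simp
qed

lemma passage_paths_0: "passage_paths k 0 n = (if n = 0 then {[]} else {})"
proof -
  have "C = []" if "C \<in> passage_paths k 0 n" for C
    using that by (cases C) (auto simp: passage_paths_def)
  moreover have "[] \<in> passage_paths k 0 n \<longleftrightarrow> n = 0"
    by (auto simp: passage_paths_def)
  ultimately show ?thesis
    by auto
qed

lemma count_list_replicate: "count_list (replicate l x) y = (if x = y then l else 0)"
  by (induction l) auto

text \<open>Removing a chunk lowers the number of chunks by one whatever its length
  \<open>l\<close>, so one induction hypothesis serves all summands of the recursion.\<close>

lemma chunk_count_diff: "l \<le> n \<Longrightarrow> h + k * l + k * (n - l) = h + k * n" for h k l n :: nat
  by (metis add.assoc distrib_left le_add_diff_inverse)

lemma chunk_mem_passage_paths_iff: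
  "replicate l (up k) @ down # C \<in> passage_paths k (Suc h) n
     \<longleftrightarrow> l \<le> n \<and> C \<in> passage_paths k (h + k * l) (n - l)"
proof -
  have "stays_pos (int (Suc h)) (replicate l (up k) @ down # C) \<longleftrightarrow> stays_pos (int (h + k * l)) C"
    using stays_pos_replicate_up[of "int (Suc h)"] by simp
  moreover have "k * (n - l) + (h + k * l) = k * n + h" if "l \<le> n"
    using chunk_count_diff[OF that, of h k] by simp
  ultimately show ?thesis
    by (auto simp: passage_paths_def count_list_replicate set_replicate_conv_if)
qed

text \<open>The first down step ends the first chunk; the height after it is
  \<open>Suc h + k * l - 1\<close>.\<close>

lemma passage_paths_Suc:
  "passage_paths k (Suc h) n =
     (\<lambda>(l, C). replicate l (up k) @ down # C) ` (SIGMA l:{..n}. passage_paths k (h + k * l) (n - l))"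
    (is "?L = ?g ` ?S")
proof
  show "?L \<subseteq> ?g ` ?S"
  proof
    fix C assume C: "C \<in> ?L"
    then have "count_list C down \<noteq> 0"
      by (simp add: passage_paths_def)
    then have "down \<in> set C"
      using count_notin by metis
    then obtain A B where AB: "C = A @ down # B" "down \<notin> set A"
      by (meson split_list_first)
    have "\<forall>x\<in>set A. x = up k"
      using C AB by (auto simp: passage_paths_def)
    then have eq: "C = ?g (length A, B)"
      using AB(1) by (simp add: replicate_length_same)
    with C have "(length A, B) \<in> ?S"
      by (simp add: chunk_mem_passage_paths_iff)
    with eq show "C \<in> ?g ` ?S"
      by (rule image_eqI)
  qed
  show "?g ` ?S \<subseteq> ?L"
    using chunk_mem_passage_paths_iff by auto
qed

lemma inj_chunk: "inj (\<lambda>(l, C). replicate l (up k) @ down # C)"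
proof (rule injI, clarsimp)
  show "l = l' \<and> C = C'" if "replicate l (up k) @ down # C = replicate l' (up k) @ down # C'"
    for l l' C C'
    using that
  proof (induction l arbitrary: l')
    case 0
    then show ?case by (cases l') auto
  next
    case (Suc l)
    then show ?case by (cases l') auto
  qed
qed

section \<open>The recursion for weighted sums and the link with Catalan paths\<close>

definition passage_sum :: "(nat \<Rightarrow> complex) \<Rightarrow> nat \<Rightarrow> nat \<Rightarrow> nat \<Rightarrow> complex" where
  "passage_sum f k j n = (\<Sum>C \<in> passage_paths k j n. weight f k C)"

lemma passage_sum_0: "passage_sum f k 0 n = (if n = 0 then 1 else 0)"
  by (simp add: passage_sum_def passage_paths_0 weight_def up_blocks_def)

lemma passage_sum_Suc:
  "passage_sum f k (Suc h) n =
     (\<Sum>l\<le>n. fps_nth (unit_series f) l * passage_sum f k (h + k * l) (n - l))"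
proof -
  have "passage_sum f k (Suc h) n =
      (\<Sum>(l, C) \<in> (SIGMA l:{..n}. passage_paths k (h + k * l) (n - l)).
         weight f k (replicate l (up k) @ down # C))"
    unfolding passage_sum_def passage_paths_Suc
    by (subst sum.reindex[OF inj_on_subset[OF inj_chunk subset_UNIV]])
      (simp add: case_prod_unfold)
  also have "\<dots> = (\<Sum>l\<le>n. \<Sum>C\<in>passage_paths k (h + k * l) (n - l).
      fps_nth (unit_series f) l * weight f k C)"
    by (simp add: sum.Sigma finite_passage_paths weight_chunk)
  finally show ?thesis
    by (simp add: passage_sum_def sum_distrib_left)
qed

text \<open>Starting at height 1 turns nonnegativity into positivity, and the appended step makes
  the last vertex of the Catalan path a tested one.\<close>

lemma passage_paths_1: "passage_paths k 1 n = (\<lambda>C. C @ [down]) ` catalan_paths k n"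
proof -
  have pos_iff: "stays_pos 1 (C @ [down]) \<longleftrightarrow> (\<forall>i \<le> length C. 0 \<le> snd (sum_list (take i C)))" for C
    unfolding stays_pos_def by (auto simp: less_Suc_eq_le)
  have sum_iff: "sum_list C = (int ((k + 1) * n), 0) \<longleftrightarrow>
      count_list C (up k) = n \<and> count_list C down = k * n" if "set C \<subseteq> {up k, down}" for C
  proof
    assume "sum_list C = (int ((k + 1) * n), 0)"
    then have 1: "int (count_list C (up k)) + int (count_list C down) = int ((k + 1) * n)"
      and 2: "int (count_list C down) = int k * int (count_list C (up k))"
      using sum_list_steps[OF that] by auto
    \<comment> \<open>Substituting the second equation into the first leaves the nonzero common
      factor \<open>k + 1\<close>.\<close>
    from 1 2 have "int (k + 1) * int (count_list C (up k)) = int (k + 1) * int n"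
      by (simp add: algebra_simps)
    then have "count_list C (up k) = n"
      by (simp del: of_nat_Suc of_nat_add)
    with 2 show "count_list C (up k) = n \<and> count_list C down = k * n"
      by (metis of_nat_eq_iff of_nat_mult)
  qed (use sum_list_steps[OF that] in \<open>simp add: algebra_simps\<close>)
  have mem_iff: "C @ [down] \<in> passage_paths k 1 n \<longleftrightarrow> C \<in> catalan_paths k n" for C
    using sum_iff[of C] pos_iff[of C] by (auto simp: passage_paths_def catalan_paths_def)
  have "\<exists>D. C = D @ [down]" if "C \<in> passage_paths k 1 n" for C
  proof (cases C rule: rev_cases)
    case Nil
    then show ?thesis using that by (auto simp: passage_paths_def)
  next
    case (snoc D x)
    \<comment> \<open>The height is positive before the last step and 0 after it, so this step
      cannot go up.\<close>
    have steps: "set C \<subseteq> {up k, down}" and "snd (sum_list C) = -1"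
      using that sum_list_steps[of C k] by (auto simp: passage_paths_def)
    moreover have "0 < 1 + snd (sum_list D)"
      using that snoc by (auto simp: passage_paths_def stays_pos_def)
    ultimately have "x \<noteq> up k"
      using snoc by auto
    then show ?thesis
      using snoc steps by auto
  qed
  with mem_iff show ?thesis
    by blast
qed

lemma path_sum_eq_passage_sum: "path_sum f k n = passage_sum f k 1 n"
proof -
  have "inj_on (\<lambda>C. C @ [down]) (catalan_paths k n)"
    by (auto intro: inj_onI)
  then show ?thesis
    unfolding path_sum_weight passage_sum_def passage_paths_1
    by (simp add: sum.reindex weight_append_down)
qed

section \<open>The closed form by comparing coefficients\<close>

lemma fps_nth_mult_atMost: "fps_nth (A * B) n = (\<Sum>l\<le>n. fps_nth A l * fps_nth B (n - l))"
  by (simp add: fps_mult_nth atLeast0AtMost)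

text \<open>The operator \<open>x d/dx\<close> multiplies the coefficient of \<open>x^n\<close> by
  \<open>n\<close>; apply it to \<open>F ^ Suc N\<close> with the power rule.\<close>

lemma fps_nth_weighted_convolution:
  fixes F :: "complex fps"
  shows "of_nat (Suc N) * (\<Sum>l\<le>n. of_nat l * fps_nth F l * fps_nth (F ^ N) (n - l))
    = of_nat n * fps_nth (F ^ Suc N) n"
proof -
  have nth: "fps_nth (fps_X * fps_deriv G) m = of_nat m * fps_nth G m" for G :: "complex fps" and m
    by (cases m) simp_all
  have "(\<Sum>l\<le>n. of_nat l * fps_nth F l * fps_nth (F ^ N) (n - l)) = fps_nth (fps_X * fps_deriv F * F ^ N) n"
    by (subst fps_nth_mult_atMost) (simp only: nth)
  moreover have "fps_X * fps_deriv (F ^ Suc N) = of_nat (Suc N) * (fps_X * fps_deriv F * F ^ N)"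
    by (simp only: fps_deriv_power' diff_Suc_1 mult_ac)
  ultimately show ?thesis
    using nth[of "F ^ Suc N" n] by (simp only: fps_mult_of_nat_nth)
qed

text \<open>The quotient form, multiplied out so that it also covers \<open>j = n = 0\<close>.\<close>

lemma passage_sum_closed:
  assumes "k \<ge> 1"
  shows "of_nat (j + k * n) * passage_sum f k j n
    = of_nat j * fps_nth (unit_series f ^ (j + k * n)) n"
proof (induction "j + k * n" arbitrary: j n)
  case 0
  then show ?case by simp
next
  case (Suc N)
  let ?F = "unit_series f"
  show ?case
  proof (cases j)
    case 0
    then show ?thesis by (simp add: passage_sum_0)
  next
    case j: (Suc h)
    have N: "N = h + k * n"
      using Suc.hyps(2) j by simp
    have IH: "of_nat N * passage_sum f k (h + k * l) (n - l)
        = of_nat (h + k * l) * fps_nth (?F ^ N) (n - l)" if "l \<le> n" for l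
    proof -
      have "N = h + k * l + k * (n - l)"
        using chunk_count_diff[OF that, of h k] N by simp
      then show ?thesis
        using Suc.hyps(1) by metis
    qed
    show ?thesis
    \<comment> \<open>A factor \<open>N\<close> is cancelled at the end, so \<open>N = 0\<close> is
      treated apart; there \<open>k \<ge> 1\<close> forces \<open>n = 0\<close>.\<close>
    proof (cases "N = 0")
      case True
      then have "h = 0" "n = 0"
        using N assms by auto
      then show ?thesis
        using j by (simp add: passage_sum_Suc passage_sum_0)
    next
      case False
      have "of_nat N * passage_sum f k j n
          = (\<Sum>l\<le>n. fps_nth ?F l * (of_nat (h + k * l) * fps_nth (?F ^ N) (n - l)))"
        unfolding j passage_sum_Suc sum_distrib_left
        using IH by (intro sum.cong) (auto simp: mult.left_commute)
      also have "\<dots> = of_nat h * fps_nth (?F ^ Suc N) n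
          + of_nat k * (\<Sum>l\<le>n. of_nat l * fps_nth ?F l * fps_nth (?F ^ N) (n - l))"
        by (simp add: fps_nth_mult_atMost sum_distrib_left algebra_simps sum.distrib)
      \<comment> \<open>The factor \<open>Suc N\<close> makes the second sum an instance of the
        weighted convolution.\<close>
      finally have "of_nat (Suc N) * (of_nat N * passage_sum f k j n)
          = of_nat (Suc N) * (of_nat h * fps_nth (?F ^ Suc N) n)
            + of_nat k * (of_nat n * fps_nth (?F ^ Suc N) n)"
        using fps_nth_weighted_convolution[of N ?F n] by (simp only: distrib_left mult.left_commute)
      also have "\<dots> = of_nat (Suc N * h + k * n) * fps_nth (?F ^ Suc N) n"
        by (simp only: of_nat_add of_nat_mult distrib_right mult.assoc)
      \<comment> \<open>By \<open>N = h + k * n\<close>, the left side is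
        \<open>N * h + N\<close>.\<close>
      also have "Suc N * h + k * n = N * j"
        using N j by (simp add: algebra_simps)
      finally have "of_nat N * (of_nat (Suc N) * passage_sum f k j n)
          = of_nat N * (of_nat j * fps_nth (?F ^ Suc N) n)"
        by (simp only: of_nat_mult mult.assoc mult.left_commute)
      then show ?thesis
        using False Suc.hyps(2) by (simp del: power_Suc of_nat_Suc)
    qed
  qed
qed

section \<open>Multiplicativity in the starting height and the functional equation\<close>

text \<open>Combinatorially, a descent from \<open>a + b\<close> splits where it first reaches
  height \<open>b\<close>. The proof instead splits off the first chunk and inducts on the number of
  chunks of the descent from \<open>a\<close>.\<close>

lemma passage_sum_add:
  assumes "k \<ge> 1"
  shows "passage_sum f k (a + b) n = (\<Sum>m\<le>n. passage_sum f k a m * passage_sum f k b (n - m))"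
proof (induction "a + k * n" arbitrary: a n)
  case 0
  then show ?case using assms by (simp add: passage_sum_0)
next
  case (Suc N)
  let ?F = "unit_series f"
  show ?case
  proof (cases a)
    case 0
    then show ?thesis
      by (simp add: passage_sum_0 if_distrib[of "\<lambda>x. x * _"] cong: if_cong)
  next
    case a: (Suc h)
    have IH: "passage_sum f k (h + b + k * l) (n - l)
        = (\<Sum>m\<le>n - l. passage_sum f k (h + k * l) m * passage_sum f k b (n - l - m))"
      if "l \<le> n" for l
    proof -
      have "N = h + k * l + k * (n - l)"
        using chunk_count_diff[OF that, of h k] a Suc.hyps(2) by simp
      from Suc.hyps(1)[OF this] show ?thesis
        by (simp add: ac_simps)
    qed
    have "passage_sum f k (a + b) n
        = (\<Sum>l\<le>n. \<Sum>m\<le>n - l. fps_nth ?F l * passage_sum f k (h + k * l) m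
                               * passage_sum f k b (n - l - m))"
      unfolding a add_Suc passage_sum_Suc
      by (intro sum.cong refl) (simp add: IH sum_distrib_left mult.assoc)
    \<comment> \<open>Reindex by the number \<open>m\<close> of up steps in the first descent, its
      first chunk included.\<close>
    also have "\<dots> = (\<Sum>m\<le>n. \<Sum>l\<le>m. fps_nth ?F l * passage_sum f k (h + k * l) (m - l)
                               * passage_sum f k b (n - m))"
      unfolding sum.Sigma[OF finite_atMost ballI[OF finite_atMost]]
      by (rule sum.reindex_bij_witness[where i = "\<lambda>(m, l). (l, m - l)" and j = "\<lambda>(l, m). (l + m, l)"])
        auto
    finally show ?thesis
      by (simp add: a passage_sum_Suc sum_distrib_right)
  qed
qed

text \<open>Down steps have size 1, so a descent from \<open>j\<close> is a sequence of
  \<open>j\<close> descents by one level.\<close>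

lemma Abs_fps_passage_sum:
  assumes "k \<ge> 1"
  shows "Abs_fps (passage_sum f k j) = Abs_fps (passage_sum f k 1) ^ j"
proof (induction j)
  case 0
  show ?case by (simp add: fps_eq_iff passage_sum_0)
next
  case (Suc j)
  have "Abs_fps (passage_sum f k (1 + j)) = Abs_fps (passage_sum f k 1) * Abs_fps (passage_sum f k j)"
    unfolding fps_eq_iff fps_nth_mult_atMost fps_nth_Abs_fps passage_sum_add[OF assms] by simp
  with Suc show ?case by simp
qed

theorem theorem3p1:
  fixes f :: "nat \<Rightarrow> complex" and k :: nat
  assumes "k \<ge> 1"
  shows "(\<forall>n. path_sum f k n
            = 1 / of_nat (k * n + 1) * fps_nth (unit_series f ^ (k * n + 1)) n)
       \<and> Abs_fps (path_sum f k)
            = fps_compose (unit_series f) (fps_X * Abs_fps (path_sum f k) ^ k)"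
proof (intro conjI allI)
  fix n
  have "of_nat (k * n + 1) * path_sum f k n = fps_nth (unit_series f ^ (k * n + 1)) n"
    using passage_sum_closed[OF assms, of 1 n f] by (simp add: path_sum_eq_passage_sum add.commute)
  moreover have "of_nat (k * n + 1) \<noteq> (0 :: complex)"
    unfolding of_nat_eq_0_iff by simp
  ultimately show "path_sum f k n
      = 1 / of_nat (k * n + 1) * fps_nth (unit_series f ^ (k * n + 1)) n"
    by (metis nonzero_mult_div_cancel_left times_divide_eq_left mult_1)
next
  have eq: "path_sum f k = passage_sum f k 1"
    by (rule ext) (rule path_sum_eq_passage_sum)
  \<comment> \<open>The factor \<open>fps_X ^ l\<close> shifts the index by \<open>l\<close>, and
    the power \<open>k * l\<close> becomes a starting height. The coefficients of the composition
    are thus the right-hand side of the recursion for \<open>h = 0\<close>.\<close>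
  have "fps_nth ((fps_X * Abs_fps (passage_sum f k 1) ^ k) ^ l) n = passage_sum f k (k * l) (n - l)"
    if "l \<le> n" for l n
    using that Abs_fps_passage_sum[OF assms, of f "k * l"]
    by (simp add: power_mult_distrib fps_X_power_mult_nth flip: power_mult)
       (metis fps_nth_Abs_fps)
  then show "Abs_fps (path_sum f k)
      = fps_compose (unit_series f) (fps_X * Abs_fps (path_sum f k) ^ k)"
    unfolding eq fps_eq_iff
    using passage_sum_Suc[of f k 0] by (simp add: fps_compose_nth atLeast0AtMost)
qed

end
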